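(* Let $\mathbf R=(R,\oplus,\cdot,0,1)$ be a ring-like structure of events (RLSE), partially ordered by $x\le y$ iff $xy=x$, and write $x\perp y$ iff $x\le y\oplus 1$. Let $S$ be a set and $Q$ a set of $S$-probabilities, partially ordered by the pointwise order of functions, and let $f:(R,\le)\to(Q,\le)$ be an order-isomorphism. If $f(x\oplus y)=f(x)+f(y)$ for all $x,y\in R$ with $x\perp y$, then $Q$ is a lattice-ordered algebra of $S$-probabilities and $\mathbf R$ is isomorphic (via $f$) to it. Moreover, every lattice-ordered algebra of $S$-probabilities can be obtained this way: for every algebra of $S$-probabilities $Q_1$ which is a lattice, setting $p\oplus q:=(p\wedge q')\vee(p'\wedge q)$ makes $(Q_1,\oplus,\wedge,0,1)$ an RLSE whose induced partial order coincides with the pointwise order on $Q_1$.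
   Context: An $S$-probability is a function $p:S\to[0,1]$; $p+q$ denotes the pointwise sum, $p':=1-p$, and $p\perp q$ means $p\le q'$ pointwise. An algebra of $S$-probabilities is a set $P$ of $S$-probabilities such that (A1) the constant functions $0,1$ belong to $P$; (A2) $p'\in P$ for every $p\in P$; (A3) if $p,q,r\in P$ with $p\perp q$, $q\perp r$, $r\perp p$, then $p+q+r\in P$. It is lattice-ordered if it is a lattice under the pointwise order. A ring-like structure of events (RLSE) is an algebra $(R,\oplus,\cdot,0,1)$ of type $(2,2,0,0)$ such that $(R,\cdot,1)$ is an idempotent commutative monoid with zero element $0$ (i.e. $x0=0$), satisfying (R1) $x\oplus y= y\oplus x$; (R2) $(xy\oplus1)(x\oplus1)\oplus1= x$; (R3) $((xy\oplus1)x\oplus1)x= xy$; (R4) $xy\oplus(x\oplus1)=(xy\oplus1)x\oplus1$.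
   Formalization: Adds the hypothesis that the constant function 1 lies in Q (otherwise Q={0,1/2} is a counterexample); "isomorphic" means f preserves order, 0, 1, complement, meet, join, orthogonality and orthogonal sums, since ⊕ on non-orthogonal pairs is not determined by the RLSE axioms. *)

theory Defs
  imports Complex_Main "HOL-Algebra.Lattice" "HOL-Algebra.Ring"
begin

text \<open>
  For an arbitrary (possibly empty) set \<open>S\<close>, functions \<open>S \<rightarrow> [0,1]\<close> are represented by extensional
  functions, so that equality of \<open>S\<close>-probabilities is equality in HOL.
\<close>

definition sprobs :: "'s set \<Rightarrow> ('s \<Rightarrow> real) set" where
  "sprobs S = S \<rightarrow>\<^sub>E {0..1}"

definition sconst :: "'s set \<Rightarrow> real \<Rightarrow> 's \<Rightarrow> real" where
  "sconst S c = (\<lambda>s\<in>S. c)"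

definition splus :: "'s set \<Rightarrow> ('s \<Rightarrow> real) \<Rightarrow> ('s \<Rightarrow> real) \<Rightarrow> 's \<Rightarrow> real" where
  "splus S p q = (\<lambda>s\<in>S. p s + q s)"

definition scompl :: "'s set \<Rightarrow> ('s \<Rightarrow> real) \<Rightarrow> 's \<Rightarrow> real" where
  "scompl S p = (\<lambda>s\<in>S. 1 - p s)"

definition sle :: "'s set \<Rightarrow> ('s \<Rightarrow> real) \<Rightarrow> ('s \<Rightarrow> real) \<Rightarrow> bool" where
  "sle S p q \<longleftrightarrow> (\<forall>s\<in>S. p s \<le> q s)"

definition sorth :: "'s set \<Rightarrow> ('s \<Rightarrow> real) \<Rightarrow> ('s \<Rightarrow> real) \<Rightarrow> bool" where
  "sorth S p q \<longleftrightarrow> sle S p (scompl S q)"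

definition sprob_poset :: "'s set \<Rightarrow> ('s \<Rightarrow> real) set \<Rightarrow> ('s \<Rightarrow> real) gorder" where
  "sprob_poset S P = \<lparr>carrier = P, eq = (=), le = sle S\<rparr>"

locale sprob_algebra =
  fixes S :: "'s set" and P :: "('s \<Rightarrow> real) set"
  assumes subset_sprobs: "P \<subseteq> sprobs S"
    and zero_mem: "sconst S 0 \<in> P"
    and one_mem: "sconst S 1 \<in> P"
    and compl_mem: "p \<in> P \<Longrightarrow> scompl S p \<in> P"
    and plus_mem:
      "\<lbrakk>p \<in> P; q \<in> P; r \<in> P; sorth S p q; sorth S q r; sorth S r p\<rbrakk>
        \<Longrightarrow> splus S (splus S p q) r \<in> P"

locale lattice_sprob_algebra =
  sprob_algebra S P + lattice "sprob_poset S P" for S :: "'s set" and P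

text \<open>
  The signature \<open>(\<oplus>, \<cdot>, 0, 1)\<close> is that of the library's ring records; \<open>\<oplus>\<close> need not be associative.
\<close>

locale rlse = comm_monoid R for R :: "('a, 'm) ring_scheme" (structure) +
  assumes add_closed: "\<lbrakk>x \<in> carrier R; y \<in> carrier R\<rbrakk> \<Longrightarrow> x \<oplus> y \<in> carrier R"
    and zero_closed: "\<zero> \<in> carrier R"
    and mult_idem: "x \<in> carrier R \<Longrightarrow> x \<otimes> x = x"
    and mult_zero: "x \<in> carrier R \<Longrightarrow> x \<otimes> \<zero> = \<zero>"
    and R1: "\<lbrakk>x \<in> carrier R; y \<in> carrier R\<rbrakk> \<Longrightarrow> x \<oplus> y = y \<oplus> x"
    and R2: "\<lbrakk>x \<in> carrier R; y \<in> carrier R\<rbrakk> \<Longrightarrow> (x \<otimes> y \<oplus> \<one>) \<otimes> (x \<oplus> \<one>) \<oplus> \<one> = x"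
    and R3: "\<lbrakk>x \<in> carrier R; y \<in> carrier R\<rbrakk> \<Longrightarrow> ((x \<otimes> y \<oplus> \<one>) \<otimes> x \<oplus> \<one>) \<otimes> x = x \<otimes> y"
    and R4: "\<lbrakk>x \<in> carrier R; y \<in> carrier R\<rbrakk>
      \<Longrightarrow> x \<otimes> y \<oplus> (x \<oplus> \<one>) = (x \<otimes> y \<oplus> \<one>) \<otimes> x \<oplus> \<one>"

definition rlse_poset :: "('a, 'm) ring_scheme \<Rightarrow> 'a gorder" where
  "rlse_poset R = \<lparr>carrier = carrier R, eq = (=), le = (\<lambda>x y. x \<otimes>\<^bsub>R\<^esub> y = x)\<rparr>"

definition rlse_orth :: "('a, 'm) ring_scheme \<Rightarrow> 'a \<Rightarrow> 'a \<Rightarrow> bool" where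
  "rlse_orth R x y \<longleftrightarrow> x \<sqsubseteq>\<^bsub>rlse_poset R\<^esub> (y \<oplus>\<^bsub>R\<^esub> \<one>\<^bsub>R\<^esub>)"

definition order_iso :: "('a, 'c) gorder_scheme \<Rightarrow> ('b, 'd) gorder_scheme \<Rightarrow> ('a \<Rightarrow> 'b) \<Rightarrow> bool" where
  "order_iso A B f \<longleftrightarrow> bij_betw f (carrier A) (carrier B) \<and> order_emb A B f"

definition orth_additive :: "('a, 'm) ring_scheme \<Rightarrow> 's set \<Rightarrow> ('a \<Rightarrow> 's \<Rightarrow> real) \<Rightarrow> bool" where
  "orth_additive R S f \<longleftrightarrow>
    (\<forall>x\<in>carrier R. \<forall>y\<in>carrier R. rlse_orth R x y \<longrightarrow> f (x \<oplus>\<^bsub>R\<^esub> y) = splus S (f x) (f y))"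

text \<open>
  Isomorphism of an RLSE onto a lattice-ordered algebra of \<open>S\<close>-probabilities: \<open>f\<close> is an
  order-isomorphism that respects \<open>0\<close>, \<open>1\<close>, complement (\<open>x \<oplus> 1\<close> in \<open>R\<close>), meet (\<open>x y\<close>), join
  (\<open>(x \<oplus> 1)(y \<oplus> 1) \<oplus> 1\<close>), orthogonality, and the sum of orthogonal elements. It cannot be asked to
  respect \<open>x \<oplus> y\<close> for all \<open>x\<close>, \<open>y\<close>: the axioms of an RLSE leave for example \<open>x \<oplus> x\<close> arbitrary
  for \<open>x \<noteq> 0, 1\<close>, and the sum of \<open>S\<close>-probabilities is only partial.
\<close>

definition rlse_sprob_iso ::
  "('a, 'm) ring_scheme \<Rightarrow> 's set \<Rightarrow> ('s \<Rightarrow> real) set \<Rightarrow> ('a \<Rightarrow> 's \<Rightarrow> real) \<Rightarrow> bool" where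
  "rlse_sprob_iso R S Q f \<longleftrightarrow>
    order_iso (rlse_poset R) (sprob_poset S Q) f \<and>
    f \<zero>\<^bsub>R\<^esub> = sconst S 0 \<and>
    f \<one>\<^bsub>R\<^esub> = sconst S 1 \<and>
    (\<forall>x\<in>carrier R. f (x \<oplus>\<^bsub>R\<^esub> \<one>\<^bsub>R\<^esub>) = scompl S (f x)) \<and>
    (\<forall>x\<in>carrier R. \<forall>y\<in>carrier R. f (x \<otimes>\<^bsub>R\<^esub> y) = f x \<sqinter>\<^bsub>sprob_poset S Q\<^esub> f y) \<and>
    (\<forall>x\<in>carrier R. \<forall>y\<in>carrier R.
      f ((x \<oplus>\<^bsub>R\<^esub> \<one>\<^bsub>R\<^esub>) \<otimes>\<^bsub>R\<^esub> (y \<oplus>\<^bsub>R\<^esub> \<one>\<^bsub>R\<^esub>) \<oplus>\<^bsub>R\<^esub> \<one>\<^bsub>R\<^esub>) = f x \<squnion>\<^bsub>sprob_poset S Q\<^esub> f y) \<and>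
    (\<forall>x\<in>carrier R. \<forall>y\<in>carrier R. rlse_orth R x y \<longleftrightarrow> sorth S (f x) (f y)) \<and>
    orth_additive R S f"

definition symdiff_rlse :: "'s set \<Rightarrow> ('s \<Rightarrow> real) set \<Rightarrow> ('s \<Rightarrow> real) ring" where
  "symdiff_rlse S P =
    \<lparr>carrier = P,
     mult = (\<lambda>p q. p \<sqinter>\<^bsub>sprob_poset S P\<^esub> q),
     one = sconst S 1,
     zero = sconst S 0,
     add = (\<lambda>p q. (p \<sqinter>\<^bsub>sprob_poset S P\<^esub> scompl S q) \<squnion>\<^bsub>sprob_poset S P\<^esub>
                   (scompl S p \<sqinter>\<^bsub>sprob_poset S P\<^esub> q))\<rparr>"

end

theory Submission
  imports Defs
begin

text \<open>
  Writing \<open>x' = x \<oplus> 1\<close>, the axioms (R2) and (R3) say that an RLSE is an orthomodular lattice with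
  orthocomplementation \<open>'\<close>, and (R4) says that \<open>x \<oplus> y = (x'y')'\<close> is the join of \<open>x\<close> and \<open>y\<close> whenever
  \<open>x \<perp> y\<close>. Hence an orthoadditive order-isomorphism turns complements into complements and iterated
  orthogonal joins into sums, which gives (A3).

  Conversely, in an algebra of \<open>S\<close>-probabilities (A3) forces the sum of two orthogonal elements to be
  their join: if \<open>p, q \<le> r\<close> and \<open>p \<perp> q\<close>, then \<open>p, q, r'\<close> are pairwise orthogonal, so \<open>p + q + r' \<le> 1\<close>.
  Dually, \<open>p \<and> q' = p - q\<close> for \<open>q \<le> p\<close>, and the RLSE axioms become arithmetic identities.
\<close>

section \<open>The pointwise order\<close>

lemma sle_refl: "sle S p p"
  by (simp add: sle_def)

lemma sle_trans: "sle S p q \<Longrightarrow> sle S q r \<Longrightarrow> sle S p r"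
  unfolding sle_def by (meson order_trans)

lemma sprobs_eqI:
  assumes "p \<in> sprobs S" "q \<in> sprobs S" "\<And>s. s \<in> S \<Longrightarrow> p s = q s"
  shows "p = q"
  using assms unfolding sprobs_def by (rule PiE_ext)

text \<open>\<open>sle\<close> compares values on \<open>S\<close> only; extensionality of the
  members of \<open>sprobs S\<close> turns agreement on \<open>S\<close> into equality.\<close>

lemma sle_antisym: "p \<in> sprobs S \<Longrightarrow> q \<in> sprobs S \<Longrightarrow> sle S p q \<Longrightarrow> sle S q p \<Longrightarrow> p = q"
  by (rule sprobs_eqI) (auto simp: sle_def intro: antisym)

lemma sprobs_bounds: "p \<in> sprobs S \<Longrightarrow> s \<in> S \<Longrightarrow> 0 \<le> p s \<and> p s \<le> 1"
  by (auto simp: sprobs_def dest: PiE_mem)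

lemma scompl_in_sprobs: "p \<in> sprobs S \<Longrightarrow> scompl S p \<in> sprobs S"
  using sprobs_bounds[of p S] by (auto simp: sprobs_def scompl_def)

lemma scompl_scompl: "p \<in> sprobs S \<Longrightarrow> scompl S (scompl S p) = p"
  by (rule sprobs_eqI[of _ S]) (auto simp: scompl_in_sprobs, simp add: scompl_def)

lemma scompl_antimono: "sle S p q \<Longrightarrow> sle S (scompl S q) (scompl S p)"
  by (simp add: sle_def scompl_def)

lemma sorth_sym: "sorth S p q \<Longrightarrow> sorth S q p"
  by (auto simp: sorth_def sle_def scompl_def algebra_simps)

lemma sorth_scompl_right: "p \<in> sprobs S \<Longrightarrow> q \<in> sprobs S \<Longrightarrow> sorth S p (scompl S q) \<longleftrightarrow> sle S p q"
  by (simp add: sorth_def scompl_scompl)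

lemma sprob_poset_simps [simp]:
  "carrier (sprob_poset S Q) = Q"
  "le (sprob_poset S Q) = sle S"
  "eq (sprob_poset S Q) = (=)"
  by (simp_all add: sprob_poset_def)

lemma partial_order_sprob_poset:
  assumes "Q \<subseteq> sprobs S"
  shows "partial_order (sprob_poset S Q)"
  by unfold_locales
    (use assms in \<open>auto intro: sle_refl sle_trans sle_antisym\<close>)

text \<open>The meet is a Hilbert choice among greatest lower bounds, so antisymmetry is what pins
  down its value.\<close>

lemma (in partial_order) meet_eqI:
  assumes "greatest L m (Lower L {x, y})"
  shows "x \<sqinter> y = m"
  unfolding meet_def inf_def
  by (rule some_equality) (use assms greatest_unique in blast)+

lemma (in partial_order) join_eqI:
  assumes "least L m (Upper L {x, y})"
  shows "x \<squnion> y = m"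
  unfolding join_def sup_def
  by (rule some_equality) (use assms least_unique in blast)+

section \<open>The order of a ring-like structure of events\<close>

lemma rlse_poset_simps [simp]:
  "carrier (rlse_poset R) = carrier R"
  "le (rlse_poset R) x y \<longleftrightarrow> x \<otimes>\<^bsub>R\<^esub> y = x"
  by (simp_all add: rlse_poset_def)

lemma rlse_orth_iff: "rlse_orth R x y \<longleftrightarrow> x \<otimes>\<^bsub>R\<^esub> (y \<oplus>\<^bsub>R\<^esub> \<one>\<^bsub>R\<^esub>) = x"
  by (simp add: rlse_orth_def)

context rlse
begin

section \<open>Complementation in an RLSE\<close>

lemma compl_closed: "x \<in> carrier R \<Longrightarrow> x \<oplus> \<one> \<in> carrier R"
  by (simp add: add_closed)

text \<open>This is (R2) at \<open>y = 1\<close>, where the product collapses to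
  \<open>x' x' = x'\<close>.\<close>

lemma compl_compl: "x \<in> carrier R \<Longrightarrow> x \<oplus> \<one> \<oplus> \<one> = x"
  using R2[of x \<one>] by (simp add: mult_idem add_closed)

lemma compl_antimono:
  assumes "x \<in> carrier R" "y \<in> carrier R" "x \<otimes> y = x"
  shows "(y \<oplus> \<one>) \<otimes> (x \<oplus> \<one>) = y \<oplus> \<one>"
proof -
  have "y \<otimes> x = x" using assms by (simp add: m_comm)
  \<comment> \<open>(R2) with the roles of \<open>x\<close> and \<open>y\<close> exchanged reads
    \<open>(x' y')' = y\<close>; complementing once more gives \<open>x' y' = y'\<close>.\<close>
  then have "(x \<oplus> \<one>) \<otimes> (y \<oplus> \<one>) \<oplus> \<one> = y" using R2[of y x] assms by simp
  then have "(x \<oplus> \<one>) \<otimes> (y \<oplus> \<one>) = y \<oplus> \<one>"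
    using assms compl_compl[of "(x \<oplus> \<one>) \<otimes> (y \<oplus> \<one>)"] by (simp add: compl_closed)
  then show ?thesis using assms by (simp add: m_comm compl_closed)
qed

lemma compl_zero: "\<zero> \<oplus> \<one> = \<one>"
proof -
  \<comment> \<open>From \<open>0 <= 1'\<close>, antitonicity yields
    \<open>1 = 1'' <= 0'\<close>.\<close>
  have "\<zero> \<otimes> (\<one> \<oplus> \<one>) = \<zero>"
    by (metis m_comm mult_zero zero_closed compl_closed one_closed)
  then have "(\<one> \<oplus> \<one> \<oplus> \<one>) \<otimes> (\<zero> \<oplus> \<one>) = \<one> \<oplus> \<one> \<oplus> \<one>"
    by (intro compl_antimono) (simp_all add: zero_closed compl_closed)
  then show ?thesis by (simp add: compl_compl compl_closed zero_closed)
qed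

text \<open>At \<open>y = 0\<close>, (R3) becomes \<open>(0' x)' x = 0\<close>, and
  \<open>0' = 1\<close>.\<close>

lemma mult_compl: "x \<in> carrier R \<Longrightarrow> x \<otimes> (x \<oplus> \<one>) = \<zero>"
  using R3[of x \<zero>] by (simp add: zero_closed mult_zero compl_zero compl_closed m_comm)

text \<open>At \<open>y = 1\<close>, (R4) becomes \<open>x + x' = (x' x)' = 0'\<close>, with
  \<open>+\<close> for the ring addition.\<close>

lemma add_compl: "x \<in> carrier R \<Longrightarrow> x \<oplus> (x \<oplus> \<one>) = \<one>"
  using R4[of x \<one>] mult_compl[of x] by (simp add: compl_zero compl_closed m_comm)

lemma orth_add_eq:
  assumes "x \<in> carrier R" "y \<in> carrier R" "rlse_orth R x y"
  shows "x \<oplus> y = (x \<oplus> \<one>) \<otimes> (y \<oplus> \<one>) \<oplus> \<one>"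
proof -
  \<comment> \<open>Orthogonality makes the product \<open>y' x\<close> equal to \<open>x\<close>,
    so that (R4) for the pair \<open>y'\<close>, \<open>x\<close> has \<open>x\<close> and
    \<open>y'' = y\<close> as its two summands.\<close>
  have "(y \<oplus> \<one>) \<otimes> x = x"
    using assms by (simp add: rlse_orth_iff m_comm compl_closed)
  then show ?thesis
    using R4[of "y \<oplus> \<one>" x] assms by (simp add: compl_closed compl_compl)
qed

section \<open>Meets and joins in an RLSE\<close>

lemma mult_le_left: "x \<in> carrier R \<Longrightarrow> y \<in> carrier R \<Longrightarrow> x \<otimes> y \<otimes> x = x \<otimes> y"
  by (metis m_assoc m_comm mult_idem)

lemma mult_le_right: "x \<in> carrier R \<Longrightarrow> y \<in> carrier R \<Longrightarrow> x \<otimes> y \<otimes> y = x \<otimes> y"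
  by (simp add: m_assoc mult_idem)

lemma join_ge_left:
  assumes "x \<in> carrier R" "y \<in> carrier R"
  shows "x \<otimes> ((x \<oplus> \<one>) \<otimes> (y \<oplus> \<one>) \<oplus> \<one>) = x"
  using compl_antimono[of "(x \<oplus> \<one>) \<otimes> (y \<oplus> \<one>)" "x \<oplus> \<one>"] assms
  by (simp add: compl_closed compl_compl mult_le_left)

lemma join_ge_right:
  assumes "x \<in> carrier R" "y \<in> carrier R"
  shows "y \<otimes> ((x \<oplus> \<one>) \<otimes> (y \<oplus> \<one>) \<oplus> \<one>) = y"
  using join_ge_left[of y x] assms by (simp add: m_comm compl_closed)

lemma join_least:
  assumes "x \<in> carrier R" "y \<in> carrier R" "z \<in> carrier R" "x \<otimes> z = x" "y \<otimes> z = y"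
  shows "((x \<oplus> \<one>) \<otimes> (y \<oplus> \<one>) \<oplus> \<one>) \<otimes> z = (x \<oplus> \<one>) \<otimes> (y \<oplus> \<one>) \<oplus> \<one>"
proof -
  have "(z \<oplus> \<one>) \<otimes> ((x \<oplus> \<one>) \<otimes> (y \<oplus> \<one>)) = z \<oplus> \<one>"
    using compl_antimono[of x z] compl_antimono[of y z] assms
    by (simp add: m_assoc[symmetric] compl_closed)
  then show ?thesis
    using compl_antimono[of "z \<oplus> \<one>" "(x \<oplus> \<one>) \<otimes> (y \<oplus> \<one>)"] assms
    by (simp add: compl_closed compl_compl)
qed

end

section \<open>Orthoadditive order-isomorphisms\<close>

locale rlse_orth_iso = rlse R for R :: "('a, 'm) ring_scheme" (structure) +
  fixes S :: "'s set" and Q :: "('s \<Rightarrow> real) set" and f :: "'a \<Rightarrow> 's \<Rightarrow> real"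
  assumes Q_sprobs: "Q \<subseteq> sprobs S"
    and one_in_Q: "sconst S 1 \<in> Q"
    and iso: "order_iso (rlse_poset R) (sprob_poset S Q) f"
    and additive: "orth_additive R S f"
begin

lemma f_mem: "x \<in> carrier R \<Longrightarrow> f x \<in> Q"
  using iso by (auto simp: order_iso_def bij_betw_def)

lemma f_sprobs: "x \<in> carrier R \<Longrightarrow> f x \<in> sprobs S"
  using f_mem Q_sprobs by blast

lemma f_surj: "p \<in> Q \<Longrightarrow> \<exists>x\<in>carrier R. p = f x"
  using iso by (auto simp: order_iso_def bij_betw_def)

lemma f_le_iff: "x \<in> carrier R \<Longrightarrow> y \<in> carrier R \<Longrightarrow> sle S (f x) (f y) \<longleftrightarrow> x \<otimes> y = x"
  using iso by (simp add: order_iso_def order_emb_def)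

lemma f_add: "x \<in> carrier R \<Longrightarrow> y \<in> carrier R \<Longrightarrow> x \<otimes> (y \<oplus> \<one>) = x \<Longrightarrow> f (x \<oplus> y) = splus S (f x) (f y)"
  using additive by (simp add: orth_additive_def rlse_orth_iff)

text \<open>Both \<open>f 1\<close> and the constant 1 are greatest in \<open>Q\<close>. Order and
  additivity alone do not fix the scale: for nonempty \<open>S\<close>, mapping the two-element RLSE
  onto the constants 0 and 1/2 is an orthoadditive order-isomorphism.\<close>

lemma f_one: "f \<one> = sconst S 1"
proof -
  obtain x where x: "x \<in> carrier R" "sconst S 1 = f x"
    using f_surj one_in_Q by blast
  have "sle S (f \<one>) (f x)"
    using sprobs_bounds[OF f_sprobs[OF one_closed]]
    by (simp add: x(2)[symmetric] sle_def sconst_def)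
  moreover have "sle S (f x) (f \<one>)"
    using x(1) by (simp add: f_le_iff)
  ultimately show ?thesis
    using x by (metis sle_antisym f_sprobs one_closed)
qed

lemma f_compl:
  assumes "x \<in> carrier R"
  shows "f (x \<oplus> \<one>) = scompl S (f x)"
proof -
  \<comment> \<open>\<open>x\<close> is orthogonal to \<open>x'\<close> because
    \<open>x'' = x\<close>, so additivity applies to \<open>x + x' = 1\<close>.\<close>
  have "splus S (f x) (f (x \<oplus> \<one>)) = sconst S 1"
    using f_add[of x "x \<oplus> \<one>"] assms
    by (simp add: add_compl f_one compl_closed compl_compl mult_idem)
  then have "f x s + f (x \<oplus> \<one>) s = 1" if "s \<in> S" for s
    using that by (auto simp: splus_def sconst_def dest: fun_cong[of _ _ s])
  then show ?thesis
    using assms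
    by (intro sprobs_eqI[of _ S])
      (force simp: f_sprobs compl_closed scompl_in_sprobs, force simp: f_sprobs scompl_in_sprobs,
        simp add: scompl_def algebra_simps)
qed

lemma f_zero: "f \<zero> = sconst S 0"
proof -
  have "f \<zero> = scompl S (f \<one>)"
    by (metis f_compl compl_zero compl_compl zero_closed one_closed)
  then show ?thesis
    by (auto simp: f_one scompl_def sconst_def)
qed

lemma f_orth_iff: "x \<in> carrier R \<Longrightarrow> y \<in> carrier R \<Longrightarrow> rlse_orth R x y \<longleftrightarrow> sorth S (f x) (f y)"
  by (simp add: sorth_def f_compl[symmetric] f_le_iff compl_closed rlse_orth_iff)

lemma f_mult_greatest:
  assumes "x \<in> carrier R" "y \<in> carrier R"
  shows "greatest (sprob_poset S Q) (f (x \<otimes> y)) (Lower (sprob_poset S Q) {f x, f y})"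
proof -
  have "sle S (f z) (f (x \<otimes> y))" if "z \<in> carrier R" "sle S (f z) (f x)" "sle S (f z) (f y)" for z
    using that assms by (simp add: f_le_iff m_assoc[symmetric])
  then show ?thesis
    using assms
    by (auto simp: greatest_def Lower_def f_mem f_le_iff mult_le_left mult_le_right dest!: f_surj)
qed

lemma f_join_least:
  assumes "x \<in> carrier R" "y \<in> carrier R"
  shows "least (sprob_poset S Q) (f ((x \<oplus> \<one>) \<otimes> (y \<oplus> \<one>) \<oplus> \<one>)) (Upper (sprob_poset S Q) {f x, f y})"
  using assms
  by (auto simp: least_def Upper_def f_mem f_le_iff compl_closed join_ge_left join_ge_right join_least
      dest!: f_surj)

lemma lattice_sprob_algebra: "lattice_sprob_algebra S Q"
proof -
  interpret po: partial_order "sprob_poset S Q"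
    using Q_sprobs by (rule partial_order_sprob_poset)
  show ?thesis
  proof unfold_locales
    show "Q \<subseteq> sprobs S" "sconst S 1 \<in> Q" by (fact Q_sprobs one_in_Q)+
    show "sconst S 0 \<in> Q" using f_mem[OF zero_closed] by (simp add: f_zero)
    show "scompl S p \<in> Q" if "p \<in> Q" for p
      using f_surj[OF that] f_mem by (auto simp: f_compl[symmetric] compl_closed)
    show "splus S (splus S p q) r \<in> Q"
      if "p \<in> Q" "q \<in> Q" "r \<in> Q" "sorth S p q" "sorth S q r" "sorth S r p" for p q r
    proof -
      obtain x y z where xyz: "x \<in> carrier R" "y \<in> carrier R" "z \<in> carrier R"
        and f: "p = f x" "q = f y" "r = f z"
        using f_surj[of p] f_surj[of q] f_surj[of r] \<open>p \<in> Q\<close> \<open>q \<in> Q\<close> \<open>r \<in> Q\<close> by blast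
      have orth: "rlse_orth R x y" "rlse_orth R y z" "rlse_orth R x z"
        using that xyz sorth_sym[of S r p] by (simp_all add: f f_orth_iff)
      \<comment> \<open>\<open>z'\<close> bounds \<open>x\<close> and \<open>y\<close>, hence also
        their join \<open>x + y\<close>. This allows additivity to be used a second time.\<close>
      have "rlse_orth R (x \<oplus> y) z"
        using orth xyz by (simp add: orth_add_eq[OF xyz(1,2) orth(1)] rlse_orth_iff join_least compl_closed)
      then have "f (x \<oplus> y \<oplus> z) = splus S (splus S p q) r"
        using orth xyz f by (simp add: f_add rlse_orth_iff add_closed)
      then show ?thesis
        using f_mem[of "x \<oplus> y \<oplus> z"] xyz by (simp add: add_closed)
    qed
    show "\<exists>s. least (sprob_poset S Q) s (Upper (sprob_poset S Q) {p, q})"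
      if "p \<in> carrier (sprob_poset S Q)" "q \<in> carrier (sprob_poset S Q)" for p q
      using f_surj[of p] f_surj[of q] that f_join_least by fastforce
    show "\<exists>s. greatest (sprob_poset S Q) s (Lower (sprob_poset S Q) {p, q})"
      if "p \<in> carrier (sprob_poset S Q)" "q \<in> carrier (sprob_poset S Q)" for p q
      using f_surj[of p] f_surj[of q] that f_mult_greatest by fastforce
  qed
qed

lemma rlse_sprob_iso: "rlse_sprob_iso R S Q f"
proof -
  interpret po: partial_order "sprob_poset S Q"
    using Q_sprobs by (rule partial_order_sprob_poset)
  show ?thesis
    unfolding rlse_sprob_iso_def
    using iso additive f_zero f_one f_compl f_orth_iff
      po.meet_eqI[OF f_mult_greatest] po.join_eqI[OF f_join_least]
    by simp
qed

end

section \<open>Lattice-ordered algebras of probabilities\<close>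

context lattice_sprob_algebra
begin

abbreviation smeet (infixl \<open>\<^bold>\<and>\<close> 70) where "p \<^bold>\<and> q \<equiv> p \<sqinter>\<^bsub>sprob_poset S P\<^esub> q"
abbreviation sjoin (infixl \<open>\<^bold>\<or>\<close> 65) where "p \<^bold>\<or> q \<equiv> p \<squnion>\<^bsub>sprob_poset S P\<^esub> q"

section \<open>Lattice operations on \<open>P\<close>\<close>

lemma mem_sprobs: "p \<in> P \<Longrightarrow> p \<in> sprobs S"
  using subset_sprobs by blast

lemma smeet_closed: "p \<in> P \<Longrightarrow> q \<in> P \<Longrightarrow> p \<^bold>\<and> q \<in> P"
  using meet_closed[of p q] by simp

lemma sjoin_closed: "p \<in> P \<Longrightarrow> q \<in> P \<Longrightarrow> p \<^bold>\<or> q \<in> P"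
  using join_closed[of p q] by simp

lemma smeet_eqI:
  assumes "p \<in> P" "q \<in> P" "m \<in> P" "sle S m p" "sle S m q"
    and "\<And>r. r \<in> P \<Longrightarrow> sle S r p \<Longrightarrow> sle S r q \<Longrightarrow> sle S r m"
  shows "p \<^bold>\<and> q = m"
  using assms by (intro meet_eqI) (auto simp: greatest_def Lower_def)

lemma sjoin_eqI:
  assumes "p \<in> P" "q \<in> P" "m \<in> P" "sle S p m" "sle S q m"
    and "\<And>r. r \<in> P \<Longrightarrow> sle S p r \<Longrightarrow> sle S q r \<Longrightarrow> sle S m r"
  shows "p \<^bold>\<or> q = m"
  using assms by (intro join_eqI) (auto simp: least_def Upper_def)

lemma smeet_le:
  assumes "p \<in> P" "q \<in> P"
  shows "sle S (p \<^bold>\<and> q) p" "sle S (p \<^bold>\<and> q) q"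
  using meet_left[of p q] meet_right[of p q] assms by simp_all

lemma smeet_absorb: "p \<in> P \<Longrightarrow> q \<in> P \<Longrightarrow> sle S p q \<Longrightarrow> p \<^bold>\<and> q = p"
  by (rule smeet_eqI) (auto intro: sle_refl)

lemma smeet_comm: "p \<^bold>\<and> q = q \<^bold>\<and> p"
  by (rule meet_comm)

lemma smeet_eq_iff: "p \<in> P \<Longrightarrow> q \<in> P \<Longrightarrow> p \<^bold>\<and> q = p \<longleftrightarrow> sle S p q"
  using smeet_absorb smeet_le(2) by metis

lemma smeet_assoc: "p \<in> P \<Longrightarrow> q \<in> P \<Longrightarrow> r \<in> P \<Longrightarrow> p \<^bold>\<and> q \<^bold>\<and> r = p \<^bold>\<and> (q \<^bold>\<and> r)"
  using weak_meet_assoc[of p q r] by simp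

section \<open>Bounds, complements and orthogonal sums\<close>

lemma zero_le: "p \<in> P \<Longrightarrow> sle S (sconst S 0) p"
  using sprobs_bounds[OF mem_sprobs] by (simp add: sle_def sconst_def)

lemma le_one: "p \<in> P \<Longrightarrow> sle S p (sconst S 1)"
  using sprobs_bounds[OF mem_sprobs] by (simp add: sle_def sconst_def)

lemma scompl_one: "scompl S (sconst S 1) = sconst S 0"
  by (auto simp: scompl_def sconst_def)

lemma splus_closed:
  assumes "p \<in> P" "q \<in> P" "sorth S p q"
  shows "splus S p q \<in> P"
proof -
  \<comment> \<open>(A3) with the constant 0 as third summand, which is orthogonal to
    everything.\<close>
  have "splus S (splus S p q) (sconst S 0) \<in> P"
    using assms zero_mem sprobs_bounds[OF mem_sprobs]
    by (intro plus_mem) (auto simp: sorth_def sle_def scompl_def sconst_def)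
  also have "splus S (splus S p q) (sconst S 0) = splus S p q"
    by (auto simp: splus_def sconst_def)
  finally show ?thesis .
qed

lemma sjoin_orth:
  assumes "p \<in> P" "q \<in> P" "sorth S p q"
  shows "p \<^bold>\<or> q = splus S p q"
proof (rule sjoin_eqI)
  show "splus S p q \<in> P" using assms by (rule splus_closed)
  show "sle S p (splus S p q)" "sle S q (splus S p q)"
    using assms sprobs_bounds[OF mem_sprobs] by (auto simp: sle_def splus_def)
  fix r assume r: "r \<in> P" "sle S p r" "sle S q r"
  have "splus S (splus S p q) (scompl S r) \<in> P"
    using assms r
    by (intro plus_mem) (auto intro: compl_mem sorth_sym simp: sorth_scompl_right mem_sprobs)
  then have "splus S (splus S p q) (scompl S r) s \<le> 1" if "s \<in> S" for s
    using sprobs_bounds[OF mem_sprobs that] by simp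
  then show "sle S (splus S p q) r"
    by (fastforce simp: sle_def splus_def scompl_def)
qed (use assms in auto)

text \<open>De Morgan's law, because complementation is an antitone involution of
  \<open>P\<close>.\<close>

lemma scompl_smeet:
  assumes "p \<in> P" "q \<in> P"
  shows "scompl S (p \<^bold>\<and> q) = scompl S p \<^bold>\<or> scompl S q"
proof (rule HOL.sym, rule sjoin_eqI)
  fix r assume r: "r \<in> P" "sle S (scompl S p) r" "sle S (scompl S q) r"
  have "sle S (scompl S r) (p \<^bold>\<and> q)"
    using meet_le[of "scompl S r" p q] r assms compl_mem[of r]
      scompl_antimono[OF r(2)] scompl_antimono[OF r(3)]
    by (simp add: scompl_scompl mem_sprobs)
  then show "sle S (scompl S (p \<^bold>\<and> q)) r"
    using scompl_antimono r(1) by (metis scompl_scompl mem_sprobs)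
qed (use assms in \<open>auto intro!: compl_mem smeet_closed scompl_antimono smeet_le\<close>)

text \<open>De Morgan gives the join of \<open>q\<close> and \<open>p'\<close>, which are orthogonal
  since \<open>q <= p\<close>; their join is therefore their sum. Equivalently, the meet of
  \<open>q'\<close> and \<open>p\<close> is the difference \<open>p - q\<close>.\<close>

lemma scompl_smeet_scompl:
  assumes "p \<in> P" "q \<in> P" "sle S q p"
  shows "scompl S (scompl S q \<^bold>\<and> p) = splus S q (scompl S p)"
proof -
  have "sorth S q (scompl S p)"
    using assms by (simp add: sorth_scompl_right mem_sprobs)
  then show ?thesis
    using assms by (simp add: scompl_smeet compl_mem scompl_scompl mem_sprobs sjoin_orth)
qed

text \<open>The orthomodular law, reduced to the pointwise identity \<open>p - (p - q) = q\<close>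
  by using the difference formula twice.\<close>

lemma smeet_orthomodular:
  assumes "p \<in> P" "q \<in> P" "sle S q p"
  shows "scompl S (scompl S q \<^bold>\<and> p) \<^bold>\<and> p = q"
proof -
  define r where "r = scompl S q \<^bold>\<and> p"
  have r: "r \<in> P" "sle S r p"
    using assms by (simp_all add: r_def smeet_closed compl_mem smeet_le)
  have "scompl S r = splus S q (scompl S p)"
    unfolding r_def using assms by (rule scompl_smeet_scompl)
  then have "r s = p s - q s" if "s \<in> S" for s
    using that by (auto simp: splus_def scompl_def dest: fun_cong[of _ _ s])
  moreover have "scompl S (scompl S r \<^bold>\<and> p) = splus S r (scompl S p)"
    using assms r by (intro scompl_smeet_scompl)
  then have "(scompl S r \<^bold>\<and> p) s = p s - r s" if "s \<in> S" for s
    using that by (auto simp: splus_def scompl_def dest: fun_cong[of _ _ s])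
  ultimately show ?thesis
    unfolding r_def[symmetric] using assms r
    by (intro sprobs_eqI[of _ S]) (auto intro: mem_sprobs smeet_closed compl_mem)
qed

lemma sjoin_zero: "p \<in> P \<Longrightarrow> sconst S 0 \<^bold>\<or> p = p"
  by (rule sjoin_eqI) (auto intro: zero_mem zero_le sle_refl)

section \<open>The symmetric difference\<close>

lemma symdiff_rlse_simps [simp]:
  "carrier (symdiff_rlse S P) = P"
  "p \<otimes>\<^bsub>symdiff_rlse S P\<^esub> q = p \<^bold>\<and> q"
  "\<one>\<^bsub>symdiff_rlse S P\<^esub> = sconst S 1"
  "\<zero>\<^bsub>symdiff_rlse S P\<^esub> = sconst S 0"
  by (simp_all add: symdiff_rlse_def)

lemma symdiff_add: "p \<oplus>\<^bsub>symdiff_rlse S P\<^esub> q = (p \<^bold>\<and> scompl S q) \<^bold>\<or> (scompl S p \<^bold>\<and> q)"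
  by (simp add: symdiff_rlse_def)

lemma symdiff_one:
  assumes "p \<in> P"
  shows "p \<oplus>\<^bsub>symdiff_rlse S P\<^esub> sconst S 1 = scompl S p"
proof -
  have "p \<^bold>\<and> sconst S 0 = sconst S 0"
    using assms smeet_absorb[OF zero_mem assms] by (simp add: zero_le smeet_comm)
  moreover have "scompl S p \<^bold>\<and> sconst S 1 = scompl S p"
    using assms by (simp add: smeet_absorb le_one one_mem compl_mem)
  ultimately show ?thesis
    using assms by (simp add: symdiff_add scompl_one sjoin_zero compl_mem)
qed

text \<open>For orthogonal \<open>p\<close> and \<open>q\<close> the two meets in the symmetric
  difference are \<open>p\<close> and \<open>q\<close> themselves, leaving an orthogonal
  join.\<close>

lemma symdiff_orth:
  assumes "p \<in> P" "q \<in> P" "sorth S p q"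
  shows "p \<oplus>\<^bsub>symdiff_rlse S P\<^esub> q = splus S p q"
proof -
  have "p \<^bold>\<and> scompl S q = p" "q \<^bold>\<and> scompl S p = q"
    using assms sorth_sym[OF assms(3)] by (simp_all add: smeet_absorb compl_mem sorth_def)
  then show ?thesis
    using assms by (simp add: symdiff_add smeet_comm[of "scompl S p" q] sjoin_orth)
qed

lemma rlse_symdiff: "rlse (symdiff_rlse S P)"
proof unfold_locales
  let ?R = "symdiff_rlse S P"
  fix x y assume "x \<in> carrier ?R" "y \<in> carrier ?R"
  then have xy: "x \<in> P" "y \<in> P" "x \<^bold>\<and> y \<in> P" "sle S (x \<^bold>\<and> y) x"
    by (simp_all add: smeet_closed smeet_le)
  show "x \<otimes>\<^bsub>?R\<^esub> y \<in> carrier ?R" "x \<oplus>\<^bsub>?R\<^esub> y \<in> carrier ?R"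
    using xy by (simp_all add: symdiff_add smeet_closed sjoin_closed compl_mem)
  show "x \<otimes>\<^bsub>?R\<^esub> y = y \<otimes>\<^bsub>?R\<^esub> x"
    by (simp add: smeet_comm)
  show "x \<oplus>\<^bsub>?R\<^esub> y = y \<oplus>\<^bsub>?R\<^esub> x"
    unfolding symdiff_add smeet_comm[of y] smeet_comm[of "scompl S y"] by (rule join_comm)
  \<comment> \<open>For (R2): the meet of \<open>x\<close> and \<open>y\<close> lies below
    \<open>x\<close>, so its complement absorbs \<open>x'\<close>, and the left side reduces to
    \<open>x''\<close>.\<close>
  have "scompl S x \<^bold>\<and> scompl S (x \<^bold>\<and> y) = scompl S x"
    using xy by (intro smeet_absorb scompl_antimono compl_mem)
  then have "scompl S (x \<^bold>\<and> y) \<^bold>\<and> scompl S x = scompl S x"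
    by (simp only: smeet_comm)
  then show "(x \<otimes>\<^bsub>?R\<^esub> y \<oplus>\<^bsub>?R\<^esub> \<one>\<^bsub>?R\<^esub>) \<otimes>\<^bsub>?R\<^esub> (x \<oplus>\<^bsub>?R\<^esub> \<one>\<^bsub>?R\<^esub>) \<oplus>\<^bsub>?R\<^esub> \<one>\<^bsub>?R\<^esub> = x"
    using xy by (simp add: symdiff_one compl_mem scompl_scompl mem_sprobs)
  \<comment> \<open>(R3) is the orthomodular law for the meet of \<open>x\<close> and
    \<open>y\<close> below \<open>x\<close>.\<close>
  show "((x \<otimes>\<^bsub>?R\<^esub> y \<oplus>\<^bsub>?R\<^esub> \<one>\<^bsub>?R\<^esub>) \<otimes>\<^bsub>?R\<^esub> x \<oplus>\<^bsub>?R\<^esub> \<one>\<^bsub>?R\<^esub>) \<otimes>\<^bsub>?R\<^esub> x = x \<otimes>\<^bsub>?R\<^esub> y"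
    using xy by (simp add: symdiff_one compl_mem smeet_closed smeet_orthomodular)
  \<comment> \<open>Both sides of (R4) are the pointwise sum of \<open>x'\<close> and the meet of
    \<open>x\<close> and \<open>y\<close>: the left by orthogonality, the right by the difference
    formula.\<close>
  show "x \<otimes>\<^bsub>?R\<^esub> y \<oplus>\<^bsub>?R\<^esub> (x \<oplus>\<^bsub>?R\<^esub> \<one>\<^bsub>?R\<^esub>) = (x \<otimes>\<^bsub>?R\<^esub> y \<oplus>\<^bsub>?R\<^esub> \<one>\<^bsub>?R\<^esub>) \<otimes>\<^bsub>?R\<^esub> x \<oplus>\<^bsub>?R\<^esub> \<one>\<^bsub>?R\<^esub>"
    using xy
    by (simp add: symdiff_one symdiff_orth scompl_smeet_scompl sorth_scompl_right mem_sprobs smeet_closed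
        compl_mem)
qed (simp_all add: one_mem zero_mem smeet_assoc smeet_absorb le_one zero_le sle_refl
    smeet_comm[of "sconst S 1"] smeet_comm[of _ "sconst S 0"])

lemma symdiff_le_iff:
  "p \<in> P \<Longrightarrow> q \<in> P \<Longrightarrow> p \<sqsubseteq>\<^bsub>rlse_poset (symdiff_rlse S P)\<^esub> q \<longleftrightarrow> sle S p q"
  by (simp add: smeet_eq_iff)

text \<open>Together with the agreement of the two orders, this makes the identity map an instance
  of the first half of the theorem, so every lattice-ordered algebra does arise in that way.\<close>

lemma orth_additive_symdiff: "orth_additive (symdiff_rlse S P) S (\<lambda>p. p)"
  by (auto simp: orth_additive_def rlse_orth_iff symdiff_one smeet_eq_iff compl_mem
      sorth_def[symmetric] symdiff_orth)

end

theorem theorem2p6: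
  fixes R :: "('a, 'm) ring_scheme" and S :: "'s set" and f :: "'a \<Rightarrow> 's \<Rightarrow> real"
  shows "(\<forall>Q. rlse R \<and> Q \<subseteq> sprobs S \<and> sconst S 1 \<in> Q \<and>
        order_iso (rlse_poset R) (sprob_poset S Q) f \<and> orth_additive R S f \<longrightarrow>
          lattice_sprob_algebra S Q \<and> rlse_sprob_iso R S Q f) \<and>
    (\<forall>Q\<^sub>1. lattice_sprob_algebra S Q\<^sub>1 \<longrightarrow>
          rlse (symdiff_rlse S Q\<^sub>1) \<and>
          (\<forall>p\<in>Q\<^sub>1. \<forall>q\<in>Q\<^sub>1. p \<sqsubseteq>\<^bsub>rlse_poset (symdiff_rlse S Q\<^sub>1)\<^esub> q \<longleftrightarrow> sle S p q) \<and>
          orth_additive (symdiff_rlse S Q\<^sub>1) S (\<lambda>p. p))"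
proof (intro conjI allI impI)
  fix Q
  assume "rlse R \<and> Q \<subseteq> sprobs S \<and> sconst S 1 \<in> Q \<and>
    order_iso (rlse_poset R) (sprob_poset S Q) f \<and> orth_additive R S f"
  then interpret rlse_orth_iso R S Q f
    by (simp add: rlse_orth_iso_def rlse_orth_iso_axioms_def)
  show "lattice_sprob_algebra S Q" "rlse_sprob_iso R S Q f"
    by (fact lattice_sprob_algebra rlse_sprob_iso)+
next
  fix Q\<^sub>1 :: "('s \<Rightarrow> real) set"
  assume "lattice_sprob_algebra S Q\<^sub>1"
  then interpret lattice_sprob_algebra S Q\<^sub>1 .
  show "rlse (symdiff_rlse S Q\<^sub>1)" "orth_additive (symdiff_rlse S Q\<^sub>1) S (\<lambda>p. p)"
    by (fact rlse_symdiff orth_additive_symdiff)+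
  show "\<forall>p\<in>Q\<^sub>1. \<forall>q\<in>Q\<^sub>1. p \<sqsubseteq>\<^bsub>rlse_poset (symdiff_rlse S Q\<^sub>1)\<^esub> q \<longleftrightarrow> sle S p q"
    using symdiff_le_iff by blast
qed

end
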